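(* Let $\mathcal{H}$ be a real Hilbert space, $(S_n)_{n\in\mathbb{N}}$ a sequence of nonempty closed convex subsets of $\mathcal{H}$, and $(\Phi_n:\mathcal{H}\to\mathbb{R})_{n\in\mathbb{N}}$ a sequence of convex continuous functions with $\mathrm{lev}_{\le0}\Phi_n\ne\emptyset$ for all $n$. Let $\lambda_n,\nu_n\in(0,2)$ for all $n$, let $u_0\in\mathcal{H}$ be arbitrary, and let $(u_n)_{n\in\mathbb{N}}$ be generated by $$u_{n+1}:=T_{\Phi_n}^{(\nu_n)}(y_n),\qquad y_n:=\begin{cases}u_n-\lambda_n\frac{\Theta_n(u_n)}{\|\Theta_n'(u_n)\|^2}\Theta_n'(u_n), & \text{if }\Theta_n'(u_n)\ne0,\\ u_n, & \text{if }\Theta_n'(u_n)=0,\end{cases}$$ where the functions $\Theta_n$ (depending on $u_n$), the index sets $\mathcal{J}_n,\mathcal{I}_n$, the weights $\omega_i^{(n)}$ and the numbers $L_n$ are those defined in the context, and $\Theta_n'(u_n)$ is any subgradient of $\Theta_n$ at $u_n$. Consider the following assumptions. (B1) There is $N\subset\mathbb{N}$ with $\mathbb{N}\setminus N$ finite such that $\Omega:=\bigcap_{n\in N}\big(\mathrm{lev}_{\le0}\Phi_n\cap\mathrm{lev}_{\le0}\Theta_n\big)\ne\emptyset$. (B2) There is $\epsilon\in(0,1]$ with $\lambda_n\in[\epsilon,2-\epsilon]$ for all $n$. (B3) The set $\mathfrak{S}((u_n)_{n\in\mathbb{N}})$ of strong cluster points of $(u_n)$ is nonempty. (B4) $\check\omega:=\inf\{\omega_i^{(n)}: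 i\in\mathcal{I}_n\ne\emptyset,\ n\in\mathbb{N}\}>0$. (B5) There is $\epsilon'\in(0,1]$ with $\nu_n\in[\epsilon',2-\epsilon']$ for all $n$. (B6) There is $D>0$ with $\max\{\|\Phi_n'(u_n)\|,\|\Phi_n'(y_n)\|\}\le D$ for all $n\in\mathbb{N}$. (B7) $\Phi_n\ge0$ on $\mathcal{H}$ for all $n\in\mathbb{N}$. Then: 1. If (B1) holds, there exists $D>0$ such that $L_n\le D$ for all $n\in\mathbb{N}$. 2. If (B1), (B2) and (B4) hold, then $\lim_{n\to\infty}\max\{d(u_n,S_j): j\in\mathcal{J}_n\}=0$. 3. If (B1), (B2), (B3) and (B4) hold, then $\mathfrak{S}((u_n)_{n\in\mathbb{N}})\subset\limsup_{n\to\infty}S_n$. Moreover, if there is $u_*\in\mathcal{H}$ such that $\lim_{n\to\infty}u_n=u_*$, then $u_*\in\liminf_{n\to\infty}S_n$. 4. If (B1), (B2), (B5) and (B6) hold, then $\limsup_{n\to\infty}\Phi_n(u_n)\le0$. If, in addition, (B7) holds, then $\lim_{n\to\infty}\Phi_n(u_n)=0$. 5. Suppose $\mathcal{H}=\mathbb{R}^L$, $L\ge1$, with the standard inner product, and that $\Phi_n(\bm{x})=\max\{0,\sum_{j=1}^L w_{n,j}|x_j|-\rho\}$, where $\rho>0$ and $\bm{w}_n\in\mathbb{R}^L$ are vectors with components $w_{n,j}\in[\check\epsilon,\hat\epsilon]$ for all $n\in\mathbb{N}$ and $j\in\{1,\dots,L\}$, for some $\check\epsilon,\hat\epsilon>0$.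 If (B1), (B2) and (B5) hold, then $\mathfrak{S}((\bm{u}_n)_{n\in\mathbb{N}})\subset\limsup_{n\to\infty}B_{\ell_1}[\bm{w}_n,\rho]$. If, moreover, there is $\bm{u}_*$ with $\lim_{n\to\infty}\bm{u}_n=\bm{u}_*$, then $\bm{u}_*\in\liminf_{n\to\infty}B_{\ell_1}[\bm{w}_n,\rho]$. Here $B_{\ell_1}[\bm{w}_n,\rho]=\{\bm{x}\in\mathbb{R}^L:\sum_{j=1}^L w_{n,j}|x_j|\le\rho\}$.
   Context: $I$ is the identity, $d(x,S)=\inf_{v\in S}\|x-v\|$, $\mathrm{lev}_{\le0}\Phi=\{v\in\mathcal{H}:\Phi(v)\le0\}$. The subdifferential is $\partial\Phi(x)=\{v:\langle v,y-x\rangle+\Phi(x)\le\Phi(y)\ \forall y\in\mathcal{H}\}$, and $\Phi'(x)$ denotes an element (subgradient) of $\partial\Phi(x)$; a choice of subgradient is fixed for each function and point and used throughout. Relaxed subgradient projection: for convex continuous $\Phi$ with $\mathrm{lev}_{\le0}\Phi\ne\emptyset$ and $\nu\in(0,2)$, $T_\Phi^{(\nu)}:=I+\nu(T_\Phi-I)$, where $T_\Phi(x)=x-\frac{\Phi(x)}{\|\Phi'(x)\|^2}\Phi'(x)$ if $\Phi(x)>0$ and $T_\Phi(x)=x$ if $\Phi(x)\le0$. Its fixed point set is $\mathrm{lev}_{\le0}\Phi$. Definition of $\Theta_n$ (inductive in $n$, given $u_n$): fix an integer $q\ge1$ and let $\mathcal{J}_n:=\{\max\{0,n-q+1\},\dots,n\}$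 and $\mathcal{I}_n:=\{i\in\mathcal{J}_n: u_n\notin S_i\}$. If $\mathcal{I}_n\neq\emptyset$, choose weights $\omega_i^{(n)}\in(0,1]$, $i\in\mathcal{I}_n$, with $\sum_{i\in\mathcal{I}_n}\omega_i^{(n)}=1$, put $L_n:=\sum_{i\in\mathcal{I}_n}\omega_i^{(n)}d(u_n,S_i)$ and $$\Theta_n(x):=\sum_{i\in\mathcal{I}_n}\frac{\omega_i^{(n)}d(u_n,S_i)}{L_n}\,d(x,S_i),\quad x\in\mathcal{H}.$$ If $\mathcal{I}_n=\emptyset$, put $L_n:=0$ and $\Theta_n:=0$. When $\mathrm{lev}_{\le0}\Theta_n\neq\emptyset$, the point $y_n$ equals $T_{\Theta_n}^{(\lambda_n)}(u_n)$. For subsets $S_n$ of $\mathcal{H}$: $\liminf_{n\to\infty}S_n$ is the set of $x$ for which there exist $N\subset\mathbb{N}$ with finite complement and $x_n\in S_n$ ($n\in N$) with $\lim_{n\in N}x_n=x$; $\limsup_{n\to\infty}S_n$ is the set of $x$ for which there exist an infinite $N\subset\mathbb{N}$ and $x_n\in S_n$ ($n\in N$) with $\lim_{n\in N}x_n=x$. Strong cluster points of a sequence are norm limits of its subsequences; limits are in norm. *)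

theory Defs
  imports "HOL-Analysis.Analysis"
begin

definition lev0 :: "('a \<Rightarrow> real) \<Rightarrow> 'a set" where
  "lev0 \<Phi> = {v. \<Phi> v \<le> 0}"

definition subdifferential :: "('a::real_inner \<Rightarrow> real) \<Rightarrow> 'a \<Rightarrow> 'a set" where
  "subdifferential \<Phi> x = {v. \<forall>y. v \<bullet> (y - x) + \<Phi> x \<le> \<Phi> y}"

(* In the two definitions below g is the selected subgradient: g x is an element of the
   subdifferential of Phi at x. *)

definition subgrad_proj :: "('a::real_inner \<Rightarrow> real) \<Rightarrow> ('a \<Rightarrow> 'a) \<Rightarrow> 'a \<Rightarrow> 'a" where
  "subgrad_proj \<Phi> g x =
     (if \<Phi> x > 0 then x - (\<Phi> x / (norm (g x))\<^sup>2) *\<^sub>R g x else x)"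

definition relaxed_subgrad_proj ::
    "real \<Rightarrow> ('a::real_inner \<Rightarrow> real) \<Rightarrow> ('a \<Rightarrow> 'a) \<Rightarrow> 'a \<Rightarrow> 'a" where
  "relaxed_subgrad_proj \<nu> \<Phi> g x = x + \<nu> *\<^sub>R (subgrad_proj \<Phi> g x - x)"

(* Subtraction on nat truncates, so the lower end is max {0, n - q + 1}. *)

definition index_window :: "nat \<Rightarrow> nat \<Rightarrow> nat set" where
  "index_window q n = {n + 1 - q..n}"

definition active_indices :: "(nat \<Rightarrow> 'a set) \<Rightarrow> nat \<Rightarrow> nat \<Rightarrow> 'a \<Rightarrow> nat set" where
  "active_indices S q n v = {i \<in> index_window q n. v \<notin> S i}"

(* Below, w i is the weight of the index i at step n, and v is the current iterate u n.
   The library function infdist x A is the infimum of dist x a over a in A, for A nonempty. *)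

definition weighted_dist ::
    "(nat \<Rightarrow> 'a::real_inner set) \<Rightarrow> nat \<Rightarrow> (nat \<Rightarrow> real) \<Rightarrow> nat \<Rightarrow> 'a \<Rightarrow> real" where
  "weighted_dist S q w n v =
     (if active_indices S q n v = {} then 0
      else \<Sum>i\<in>active_indices S q n v. w i * infdist v (S i))"

definition dist_fun ::
    "(nat \<Rightarrow> 'a::real_inner set) \<Rightarrow> nat \<Rightarrow> (nat \<Rightarrow> real) \<Rightarrow> nat \<Rightarrow> 'a \<Rightarrow> 'a \<Rightarrow> real" where
  "dist_fun S q w n v x =
     (if active_indices S q n v = {} then 0
      else \<Sum>i\<in>active_indices S q n v.
             (w i * infdist v (S i) / weighted_dist S q w n v) * infdist x (S i))"

(* \<Phi>' n is a selection of subgradients of \<Phi> n at all points, while \<Theta>' n is only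
   the subgradient of \<Theta>_n = dist_fun S q (\<omega> n) n (u n) at the point u n. *)

locale subgrad_scheme =
  fixes S :: "nat \<Rightarrow> 'a::{real_inner, complete_space} set"
    and \<Phi> :: "nat \<Rightarrow> 'a \<Rightarrow> real"
    and \<Phi>' :: "nat \<Rightarrow> 'a \<Rightarrow> 'a"
    and lam \<nu> :: "nat \<Rightarrow> real"
    and q :: nat
    and \<omega> :: "nat \<Rightarrow> nat \<Rightarrow> real"
    and \<Theta>' :: "nat \<Rightarrow> 'a"
    and u y :: "nat \<Rightarrow> 'a"
  assumes S_nonempty: "S n \<noteq> {}"
    and S_closed: "closed (S n)"
    and S_convex: "convex (S n)"
    and Phi_convex: "convex_on UNIV (\<Phi> n)"
    and Phi_continuous: "continuous_on UNIV (\<Phi> n)"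
    and lev0_Phi_nonempty: "lev0 (\<Phi> n) \<noteq> {}"
    and Phi'_subgradient: "\<Phi>' n x \<in> subdifferential (\<Phi> n) x"
    and lam_range: "0 < lam n" "lam n < 2"
    and nu_range: "0 < \<nu> n" "\<nu> n < 2"
    and q_ge_1: "q \<ge> 1"
    and weight_range: "i \<in> active_indices S q n (u n) \<Longrightarrow> 0 < \<omega> n i \<and> \<omega> n i \<le> 1"
    and weight_sum: "active_indices S q n (u n) \<noteq> {} \<Longrightarrow>
                       (\<Sum>i\<in>active_indices S q n (u n). \<omega> n i) = 1"
    and Theta'_subgradient:
      "\<Theta>' n \<in> subdifferential (dist_fun S q (\<omega> n) n (u n)) (u n)"
    and y_eq:
      "y n = (if \<Theta>' n \<noteq> 0
              then u n - (lam n * (dist_fun S q (\<omega> n) n (u n) (u n) / (norm (\<Theta>' n))\<^sup>2)) *\<^sub>R \<Theta>' n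
              else u n)"
    and u_Suc: "u (Suc n) = relaxed_subgrad_proj (\<nu> n) (\<Phi> n) (\<Phi>' n) (y n)"

definition cofinitely_common_level ::
    "(nat \<Rightarrow> 'a \<Rightarrow> real) \<Rightarrow> (nat \<Rightarrow> 'a \<Rightarrow> real) \<Rightarrow> bool" where
  "cofinitely_common_level \<Phi> \<Theta> \<longleftrightarrow>
     (\<exists>N. finite (UNIV - N) \<and> (\<Inter>n\<in>N. lev0 (\<Phi> n) \<inter> lev0 (\<Theta> n)) \<noteq> {})"

definition uniformly_relaxed :: "(nat \<Rightarrow> real) \<Rightarrow> bool" where
  "uniformly_relaxed r \<longleftrightarrow> (\<exists>\<epsilon>. 0 < \<epsilon> \<and> \<epsilon> \<le> 1 \<and> (\<forall>n. \<epsilon> \<le> r n \<and> r n \<le> 2 - \<epsilon>))"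

(* The infimum is taken in ereal, so that it is \<infinity> when no index is ever active. *)

definition weights_bounded_below ::
    "(nat \<Rightarrow> 'a set) \<Rightarrow> nat \<Rightarrow> (nat \<Rightarrow> nat \<Rightarrow> real) \<Rightarrow> (nat \<Rightarrow> 'a) \<Rightarrow> bool" where
  "weights_bounded_below S q \<omega> u \<longleftrightarrow>
     Inf {ereal (\<omega> n i) | n i. i \<in> active_indices S q n (u n)} > 0"

definition subgradients_bounded ::
    "(nat \<Rightarrow> 'a \<Rightarrow> 'a::real_inner) \<Rightarrow> (nat \<Rightarrow> 'a) \<Rightarrow> (nat \<Rightarrow> 'a) \<Rightarrow> bool" where
  "subgradients_bounded \<Phi>' u y \<longleftrightarrow>
     (\<exists>D>0. \<forall>n. max (norm (\<Phi>' n (u n))) (norm (\<Phi>' n (y n))) \<le> D)"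

definition cluster_points :: "(nat \<Rightarrow> 'a::topological_space) \<Rightarrow> 'a set" where
  "cluster_points u = {x. \<exists>r. strict_mono r \<and> (u \<circ> r) \<longlonglongrightarrow> x}"

(* Limits of sets in the sense of Painleve and Kuratowski, not the order-theoretic
   liminf and limsup of the lattice of sets. The limit of xs n along n in N is taken
   with respect to the filter "inf sequentially (principal N)". *)

definition set_liminf :: "(nat \<Rightarrow> 'a::topological_space set) \<Rightarrow> 'a set" where
  "set_liminf S = {x. \<exists>N xs. finite (UNIV - N) \<and> (\<forall>n\<in>N. xs n \<in> S n) \<and>
                        (xs \<longlongrightarrow> x) (inf sequentially (principal N))}"

definition set_limsup :: "(nat \<Rightarrow> 'a::topological_space set) \<Rightarrow> 'a set" where
  "set_limsup S = {x. \<exists>N xs. infinite N \<and> (\<forall>n\<in>N. xs n \<in> S n) \<and>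
                        (xs \<longlongrightarrow> x) (inf sequentially (principal N))}"

definition weighted_l1_ball :: "real^'l \<Rightarrow> real \<Rightarrow> (real^'l) set" where
  "weighted_l1_ball w \<rho> = {x. (\<Sum>j\<in>UNIV. w $ j * \<bar>x $ j\<bar>) \<le> \<rho>}"

end

theory Submission
  imports Defs
begin

text \<open>
  Both halves of an iteration are relaxed subgradient steps towards a point of the common level
  set, so the squared distance to such a point decreases in each iteration by at least
  the sum of the squares of the two step lengths, up to constants; these lengths therefore
  tend to zero. As \<open>\<Theta>\<^sub>n\<close> is 1-Lipschitz, its subgradients have norm at most 1 and
  \<open>\<Theta>\<^sub>n (u\<^sub>n)\<close> tends to zero; it dominates the largest distance \<open>d (u\<^sub>n, S\<^sub>j)\<close> up to the lower bound
  of the weights. For the \<open>\<ell>\<^sub>1\<close> balls, rescaling \<open>u\<^sub>n\<close> into the ball moves it by at most a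
  constant times \<open>\<Phi>\<^sub>n (u\<^sub>n)\<close>.
\<close>

section \<open>Real sequences: squeezing and telescoping defects\<close>

lemma tendsto_0_squeeze:
  fixes f g :: "nat \<Rightarrow> real"
  assumes "g \<longlonglongrightarrow> 0" and "\<And>n. 0 \<le> f n" and "\<And>n. f n \<le> g n"
  shows "f \<longlonglongrightarrow> 0"
  by (rule tendsto_sandwich[OF _ _ tendsto_const assms(1)]) (auto intro!: always_eventually assms)

text \<open>From some index on, \<open>e\<close> decreases and stays nonnegative, so it converges.
  Hence \<open>e n - e (Suc n)\<close> tends to 0, and eventually it dominates \<open>c n\<close>.
  In the application \<open>e\<close> is a squared distance to a common point and \<open>c\<close>
  is the gain of one iteration.\<close>

lemma decreasing_defect_tendsto_0:
  fixes e c :: "nat \<Rightarrow> real"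
  assumes step: "\<forall>\<^sub>F n in sequentially. e (Suc n) + c n \<le> e n"
    and e: "\<And>n. 0 \<le> e n" and c: "\<And>n. 0 \<le> c n"
  shows "c \<longlonglongrightarrow> 0" and "Bseq e"
proof -
  from step obtain M where M: "\<And>n. n \<ge> M \<Longrightarrow> e (Suc n) + c n \<le> e n"
    unfolding eventually_sequentially by blast
  have "decseq (\<lambda>n. e (n + M))"
    using M c by (intro decseq_SucI) (smt (verit) add_Suc le_add2)
  then obtain l where l: "(\<lambda>n. e (n + M)) \<longlonglongrightarrow> l"
    using decseq_convergent[of "\<lambda>n. e (n + M)" 0] e by blast
  then have "e \<longlonglongrightarrow> l"
    by (rule LIMSEQ_offset)
  then show "Bseq e"
    by (blast intro: convergent_imp_Bseq convergentI)
  have lim: "(\<lambda>n. e n - e (Suc n)) \<longlonglongrightarrow> 0"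
    using tendsto_diff[OF \<open>e \<longlonglongrightarrow> l\<close> LIMSEQ_Suc[OF \<open>e \<longlonglongrightarrow> l\<close>]] by simp
  show "c \<longlonglongrightarrow> 0"
    by (rule tendsto_sandwich[OF _ _ tendsto_const lim])
      (use c in simp, use step in \<open>auto elim: eventually_mono\<close>)
qed

section \<open>Relaxed subgradient steps\<close>

text \<open>For \<open>g = 0\<close> both quotients are \<open>0\<close>, and the inequality is trivial.\<close>

lemma relaxed_step_fejer:
  fixes x z g :: "'a::real_inner"
  assumes sub: "g \<bullet> (z - x) + a \<le> 0" and a: "0 \<le> a" and r: "0 \<le> r"
  shows "(norm (x - (r * (a / (norm g)\<^sup>2)) *\<^sub>R g - z))\<^sup>2 + r * (2 - r) * (a / norm g)\<^sup>2
           \<le> (norm (x - z))\<^sup>2"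
proof (cases "g = 0")
  case False
  \<comment> \<open>Expanding the square leaves the cross term
    \<open>2 * (t * (g \<bullet> (x - z)))\<close>, which is at least \<open>2 * (t * a)\<close> by
    the subgradient inequality. What remains after subtracting the quadratic term is exactly the
    claimed gain.\<close>
  define t where "t = r * (a / (norm g)\<^sup>2)"
  have t: "0 \<le> t"
    using a r by (simp add: t_def)
  have "t * a \<le> t * (g \<bullet> (x - z))"
    using sub t by (intro mult_left_mono) (auto simp: inner_diff_right)
  moreover have "(norm (x - t *\<^sub>R g - z))\<^sup>2
      = (norm (x - z))\<^sup>2 - 2 * (t * (g \<bullet> (x - z))) + t\<^sup>2 * (norm g)\<^sup>2"
    unfolding power2_norm_eq_inner
    by (simp add: inner_diff_left inner_diff_right inner_commute algebra_simps power2_eq_square)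
  moreover have "2 * (t * a) - t\<^sup>2 * (norm g)\<^sup>2 = r * (2 - r) * (a / norm g)\<^sup>2"
    using False by (simp add: t_def field_simps power2_eq_square)
  ultimately show ?thesis
    unfolding t_def[symmetric] by linarith
qed simp

text \<open>The \<open>max 0\<close> makes the gain vanish where the projection is the identity, so
  both branches of \<open>subgrad_proj\<close> share one inequality.\<close>

lemma relaxed_subgrad_proj_fejer:
  assumes g: "g x \<in> subdifferential \<Phi> x" and z: "\<Phi> z \<le> 0" and \<nu>: "0 \<le> \<nu>"
  shows "(norm (relaxed_subgrad_proj \<nu> \<Phi> g x - z))\<^sup>2
           + \<nu> * (2 - \<nu>) * (max 0 (\<Phi> x) / norm (g x))\<^sup>2 \<le> (norm (x - z))\<^sup>2"
proof (cases "\<Phi> x > 0")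
  case True
  have "g x \<bullet> (z - x) + \<Phi> x \<le> 0"
    using g z unfolding subdifferential_def by (auto dest!: spec[of _ z])
  from relaxed_step_fejer[OF this _ \<nu>] True show ?thesis
    by (simp add: relaxed_subgrad_proj_def subgrad_proj_def)
qed (simp add: relaxed_subgrad_proj_def subgrad_proj_def max_def)

text \<open>Testing the subgradient inequality at \<open>x + g\<close> bounds the square of
  \<open>norm g\<close> by \<open>K * norm g\<close>.\<close>

lemma subgradient_norm_le:
  fixes x g :: "'a::real_inner"
  assumes g: "g \<in> subdifferential \<Phi> x" and lip: "\<And>y. \<Phi> y - \<Phi> x \<le> K * norm (y - x)"
    and K: "0 \<le> K"
  shows "norm g \<le> K"
proof (cases "g = 0")
  case False
  have "g \<bullet> ((x + g) - x) + \<Phi> x \<le> \<Phi> (x + g)"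
    using g unfolding subdifferential_def by blast
  with lip[of "x + g"] have "norm g * norm g \<le> K * norm g"
    by (simp flip: norm_eq_sqrt_inner power2_norm_eq_inner power2_eq_square)
  with False show ?thesis
    by simp
qed (simp add: K)

text \<open>This recovers the function value from the step length. The delicate case is
  \<open>g = 0\<close>, where the quotient is 0 by convention: then \<open>x\<close> is a minimiser,
  so its value is at most that at \<open>z\<close> and the left side is 0 too.\<close>

lemma le_norm_subgradient_mult:
  fixes x g :: "'a::real_inner"
  assumes g: "g \<in> subdifferential \<Phi> x" and z: "\<Phi> z \<le> 0"
  shows "max 0 (\<Phi> x) \<le> norm g * (max 0 (\<Phi> x) / norm g)"
proof (cases "g = 0")
  case True
  then have "\<Phi> x \<le> \<Phi> z"
    using g by (auto simp: subdifferential_def)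
  with z True show ?thesis
    by simp
qed simp

lemma uniformly_relaxed_step_tendsto_0:
  assumes r: "uniformly_relaxed r" and lim: "(\<lambda>n. r n * (2 - r n) * (a n)\<^sup>2) \<longlonglongrightarrow> 0"
  shows "a \<longlonglongrightarrow> 0"
proof -
  from r obtain \<epsilon> where \<epsilon>: "0 < \<epsilon>" "\<epsilon> \<le> 1" and re: "\<And>n. \<epsilon> \<le> r n \<and> r n \<le> 2 - \<epsilon>"
    unfolding uniformly_relaxed_def by blast
  have "\<epsilon> \<le> r n * (2 - r n)" for n
  proof -
    \<comment> \<open>This product equals
      \<open>r n * (2 - r n) - \<epsilon> * (2 - \<epsilon>)\<close>, and \<open>\<epsilon> * (2 -
      \<epsilon>) = \<epsilon> + \<epsilon> * (1 - \<epsilon>)\<close>.\<close>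
    have "0 \<le> (r n - \<epsilon>) * (2 - \<epsilon> - r n)"
      using re[of n] by simp
    moreover have "0 \<le> \<epsilon> * (1 - \<epsilon>)"
      using \<epsilon> by simp
    ultimately show ?thesis
      by (simp add: algebra_simps)
  qed
  then have "\<epsilon> * (a n)\<^sup>2 \<le> r n * (2 - r n) * (a n)\<^sup>2" for n
    by (intro mult_right_mono) auto
  then have le: "(a n)\<^sup>2 \<le> r n * (2 - r n) * (a n)\<^sup>2 / \<epsilon>" for n
    using \<epsilon> by (simp add: pos_le_divide_eq mult.commute)
  have "(\<lambda>n. (a n)\<^sup>2) \<longlonglongrightarrow> 0"
    by (rule tendsto_0_squeeze[OF tendsto_divide_zero[OF lim, of \<epsilon>]]) (use le in auto)
  then show ?thesis
    using tendsto_real_sqrt[of "\<lambda>n. (a n)\<^sup>2" 0] by (simp add: tendsto_rabs_zero_iff)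
qed

section \<open>Limits of sets and cofinite index sets\<close>

lemma
  fixes u s :: "nat \<Rightarrow> 'a::metric_space"
  assumes s: "\<And>n. s n \<in> C n" and d: "(\<lambda>n. dist (s n) (u n)) \<longlonglongrightarrow> 0"
  shows cluster_points_subset_set_limsup: "cluster_points u \<subseteq> set_limsup C"
    and limit_in_set_liminf: "u \<longlonglongrightarrow> x \<Longrightarrow> x \<in> set_liminf C"
proof -
  \<comment> \<open>A sequence at vanishing distance from a convergent one has the same limit. This
    is applied to \<open>s\<close> and \<open>u\<close>, and again along a subsequence.\<close>
  have dist_lim: "b \<longlonglongrightarrow> x" if "a \<longlonglongrightarrow> x" and "(\<lambda>n. dist (b n) (a n)) \<longlonglongrightarrow> 0" for a b and x :: 'a
  proof -
    have "(\<lambda>n. dist (b n) (a n) + dist (a n) x) \<longlonglongrightarrow> 0"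
      using that by (intro tendsto_add_zero) (auto simp flip: tendsto_dist_iff)
    then show ?thesis
      unfolding tendsto_dist_iff[of b]
      by (rule tendsto_0_squeeze) (auto intro: dist_triangle)
  qed
  show "x \<in> set_liminf C" if "u \<longlonglongrightarrow> x"
  proof -
    have "s \<longlonglongrightarrow> x"
      by (rule dist_lim[OF that d])
    with s show ?thesis
      unfolding set_liminf_def by (auto intro!: exI[of _ UNIV] exI[of _ s])
  qed
  show "cluster_points u \<subseteq> set_limsup C"
  proof
    fix x assume "x \<in> cluster_points u"
    then obtain r where r: "strict_mono r" and lim: "(u \<circ> r) \<longlonglongrightarrow> x"
      unfolding cluster_points_def by blast
    have "(\<lambda>n. dist (s (r n)) (u (r n))) \<longlonglongrightarrow> 0"
      using LIMSEQ_subseq_LIMSEQ[OF d r] by (simp add: o_def)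
    with lim have sr: "(\<lambda>n. s (r n)) \<longlonglongrightarrow> x"
      using dist_lim[of "\<lambda>n. u (r n)" x "\<lambda>n. s (r n)"] by (simp add: o_def)
    \<comment> \<open>\<open>set_limsup\<close> asks for a limit along a set of indices rather than
      along a subsequence. As \<open>r\<close> is strictly increasing, the elements of
      \<open>range r\<close> from \<open>r K\<close> on are the \<open>r k\<close> with
      \<open>k \<ge> K\<close>.\<close>
    have "(s \<longlongrightarrow> x) (inf sequentially (principal (range r)))"
    proof (rule tendstoI)
      fix e :: real assume "e > 0"
      with sr obtain K where K: "\<And>k. k \<ge> K \<Longrightarrow> dist (s (r k)) x < e"
        unfolding lim_sequentially by blast
      have "n \<in> range r \<longrightarrow> dist (s n) x < e" if "n \<ge> r K" for n
        using that K strict_mono_less_eq[OF r] by auto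
      then show "\<forall>\<^sub>F n in inf sequentially (principal (range r)). dist (s n) x < e"
        unfolding eventually_inf_principal eventually_sequentially by blast
    qed
    moreover have "infinite (range r)"
      using r by (simp add: range_inj_infinite strict_mono_imp_inj_on)
    ultimately show "x \<in> set_limsup C"
      unfolding set_limsup_def using s by blast
  qed
qed

text \<open>On the naturals the cofinite filter is \<open>sequentially\<close>, so the exceptional
  finite set turns into an eventual statement about one fixed point.\<close>

lemma cofinitely_common_levelE:
  assumes "cofinitely_common_level \<Phi> \<Theta>"
  obtains z where "\<forall>\<^sub>F n in sequentially. \<Phi> n z \<le> 0 \<and> \<Theta> n z \<le> 0"
proof -
  from assms obtain N z where N: "finite (UNIV - N)" and z: "\<And>n. n \<in> N \<Longrightarrow> \<Phi> n z \<le> 0 \<and> \<Theta> n z \<le> 0"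
    unfolding cofinitely_common_level_def lev0_def by blast
  from N have "\<forall>\<^sub>F n in cofinite. n \<in> N"
    by (simp add: eventually_cofinite Diff_eq Compl_eq)
  then have "\<forall>\<^sub>F n in sequentially. \<Phi> n z \<le> 0 \<and> \<Theta> n z \<le> 0"
    unfolding cofinite_eq_sequentially by (rule eventually_mono) (rule z)
  then show thesis
    by (rule that)
qed

section \<open>The averaged distance function of one iteration\<close>

context subgrad_scheme
begin

abbreviation \<Theta> :: "nat \<Rightarrow> 'a \<Rightarrow> real" where
  "\<Theta> n \<equiv> dist_fun S q (\<omega> n) n (u n)"

abbreviation I :: "nat \<Rightarrow> nat set" where
  "I n \<equiv> active_indices S q n (u n)"

abbreviation L :: "nat \<Rightarrow> real" where
  "L n \<equiv> weighted_dist S q (\<omega> n) n (u n)"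

lemma finite_active: "finite (I n)"
  by (simp add: active_indices_def index_window_def)

lemma infdist_pos: "i \<in> I n \<Longrightarrow> 0 < infdist (u n) (S i)"
  using in_closed_iff_infdist_zero[OF S_closed S_nonempty] infdist_nonneg[of "u n" "S i"]
  by (force simp: active_indices_def less_le)

lemma infdist_inactive: "j \<in> index_window q n \<Longrightarrow> j \<notin> I n \<Longrightarrow> infdist (u n) (S j) = 0"
  by (simp add: active_indices_def)

lemma L_pos:
  assumes "I n \<noteq> {}"
  shows "0 < L n"
proof -
  have "0 < (\<Sum>i\<in>I n. \<omega> n i * infdist (u n) (S i))"
    using assms weight_range infdist_pos finite_active by (intro sum_pos) auto
  with assms show ?thesis
    by (simp add: weighted_dist_def)
qed

text \<open>When \<open>I n\<close> is nonempty these are positive and sum to 1, so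
  \<open>\<Theta> n\<close> is a convex combination of distance functions and inherits their
  Lipschitz constant 1.\<close>

definition coeff :: "nat \<Rightarrow> nat \<Rightarrow> real" where
  "coeff n i = \<omega> n i * infdist (u n) (S i) / L n"

text \<open>The case distinction in \<open>dist_fun\<close> disappears because an empty sum is
  0.\<close>

lemma Theta_eq: "\<Theta> n x = (\<Sum>i\<in>I n. coeff n i * infdist x (S i))"
  by (simp add: dist_fun_def coeff_def)

lemma coeff_pos:
  assumes "i \<in> I n"
  shows "0 < coeff n i"
proof -
  have "0 < L n"
    using assms by (intro L_pos) blast
  with assms show ?thesis
    using weight_range infdist_pos by (simp add: coeff_def)
qed

lemma coeff_sum:
  assumes "I n \<noteq> {}"
  shows "(\<Sum>i\<in>I n. coeff n i) = 1"
proof -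
  have "(\<Sum>i\<in>I n. \<omega> n i * infdist (u n) (S i)) = L n"
    using assms by (simp add: weighted_dist_def)
  with L_pos[OF assms] show ?thesis
    by (simp add: coeff_def flip: sum_divide_distrib)
qed

lemma Theta_term_nonneg: "i \<in> I n \<Longrightarrow> 0 \<le> coeff n i * infdist x (S i)"
  using coeff_pos by (simp add: less_imp_le infdist_nonneg)

lemma Theta_nonneg: "0 \<le> \<Theta> n x"
  unfolding Theta_eq by (rule sum_nonneg) (rule Theta_term_nonneg)

lemma Theta_lipschitz: "\<Theta> n x - \<Theta> n x' \<le> norm (x - x')"
proof (cases "I n = {}")
  case False
  have "\<Theta> n x - \<Theta> n x' = (\<Sum>i\<in>I n. coeff n i * (infdist x (S i) - infdist x' (S i)))"
    by (simp add: Theta_eq sum_subtractf right_diff_distrib)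
  also have "\<dots> \<le> (\<Sum>i\<in>I n. coeff n i * norm (x - x'))"
    using coeff_pos infdist_triangle[of x _ x']
    by (intro sum_mono mult_left_mono) (auto simp: dist_norm less_imp_le diff_le_eq add.commute)
  also have "\<dots> = norm (x - x')"
    using coeff_sum[OF False] by (simp flip: sum_distrib_right)
  finally show ?thesis .
qed (simp add: dist_fun_def)

lemma norm_Theta'_le_1: "norm (\<Theta>' n) \<le> 1"
  by (rule subgradient_norm_le[OF Theta'_subgradient]) (use Theta_lipschitz in auto)

text \<open>A sum of nonnegative terms that is at most 0 has only zero terms. The coefficients are
  positive, so all active distances of \<open>z\<close> vanish, and the sets are closed.\<close>

lemma Theta_le_0_imp_mem:
  assumes z: "\<Theta> n z \<le> 0" and i: "i \<in> I n"
  shows "z \<in> S i"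
proof -
  have "(\<Sum>i\<in>I n. coeff n i * infdist z (S i)) = 0"
    using z Theta_nonneg[of n z] by (simp add: Theta_eq)
  then have "coeff n i * infdist z (S i) = 0"
    using i by (subst (asm) sum_nonneg_eq_0_iff) (auto simp: finite_active Theta_term_nonneg)
  with coeff_pos[OF i] show ?thesis
    using in_closed_iff_infdist_zero[OF S_closed S_nonempty] by auto
qed

text \<open>For nonempty \<open>I n\<close>, \<open>L n\<close> is a weighted average of the active
  distances; the hypothesis \<open>0 \<le> M\<close> covers the empty case.\<close>

lemma L_le:
  assumes "0 \<le> M" and "\<And>i. i \<in> I n \<Longrightarrow> infdist (u n) (S i) \<le> M"
  shows "L n \<le> M"
proof (cases "I n = {}")
  case False
  then have "L n \<le> (\<Sum>i\<in>I n. \<omega> n i * M)"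
    using assms weight_range by (auto simp: weighted_dist_def less_imp_le intro!: sum_mono mult_left_mono)
  also have "\<dots> = M"
    using weight_sum[OF False] by (simp flip: sum_distrib_right)
  finally show ?thesis .
qed (use assms in \<open>simp add: weighted_dist_def\<close>)

text \<open>At \<open>u n\<close> the term of index \<open>i\<close> is
  \<open>\<omega> n i * (infdist (u n) (S i))^2 / L n\<close>. For the largest active distance
  \<open>M\<close>, the average satisfies \<open>L n \<le> M\<close>, so that single term is already
  at least \<open>c * M\<close>. Inactive indices in the window have distance 0.\<close>

lemma infdist_le_Theta:
  assumes w: "\<And>i. i \<in> I n \<Longrightarrow> c \<le> \<omega> n i" and c: "0 < c" and j: "j \<in> index_window q n"
  shows "infdist (u n) (S j) \<le> \<Theta> n (u n) / c"
proof (cases "j \<in> I n")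
  case True
  let ?d = "\<lambda>i. infdist (u n) (S i)"
  let ?f = "\<lambda>i. coeff n i * ?d i"
  define M where "M = Max (?d ` I n)"
  from True have ne: "I n \<noteq> {}"
    by blast
  then have "M \<in> ?d ` I n"
    unfolding M_def using finite_active by (intro Max_in) auto
  then obtain m where m: "m \<in> I n" and Mm: "M = ?d m"
    by blast
  have dM: "?d i \<le> M" if "i \<in> I n" for i
    using that finite_active by (simp add: M_def)
  have M: "0 < M"
    using infdist_pos[OF m] Mm by simp
  have "L n \<le> M"
    using dM M by (intro L_le) auto
  then have "c * L n * M \<le> \<omega> n m * M * M"
    using w[OF m] c M L_pos[OF ne] by (intro mult_mono mult_right_mono) auto
  then have "c * M \<le> ?f m"
    using L_pos[OF ne] by (simp add: Mm coeff_def field_simps)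
  also have "\<dots> \<le> (\<Sum>i\<in>I n. ?f i)"
    by (rule member_le_sum[OF m _ finite_active]) (simp add: Theta_term_nonneg)
  also have "\<dots> = \<Theta> n (u n)"
    by (simp add: Theta_eq)
  finally have "M \<le> \<Theta> n (u n) / c"
    using c by (simp add: field_simps)
  with dM[OF True] show ?thesis
    by simp
next
  case False
  then show ?thesis
    using infdist_inactive[OF j] Theta_nonneg c by simp
qed

section \<open>Decrease of the distance to common points and its consequences\<close>

lemma y_step: "y n = u n - (lam n * (\<Theta> n (u n) / (norm (\<Theta>' n))\<^sup>2)) *\<^sub>R \<Theta>' n"
  \<comment> \<open>For \<open>\<Theta>' n = 0\<close> the subtracted vector is 0, so the two cases
    of \<open>y_eq\<close> merge.\<close>
  by (simp add: y_eq)

text \<open>The step from \<open>u n\<close> to \<open>y n\<close> approaches \<open>z\<close>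
  because \<open>\<Theta> n z \<le> 0\<close>, and the step from \<open>y n\<close> to
  \<open>u (Suc n)\<close> because \<open>\<Phi> n z \<le> 0\<close>; the two gains add up.\<close>

lemma fejer:
  assumes "\<Phi> n z \<le> 0" and "\<Theta> n z \<le> 0"
  shows "(norm (u (Suc n) - z))\<^sup>2 + (lam n * (2 - lam n) * (\<Theta> n (u n) / norm (\<Theta>' n))\<^sup>2
           + \<nu> n * (2 - \<nu> n) * (max 0 (\<Phi> n (y n)) / norm (\<Phi>' n (y n)))\<^sup>2)
         \<le> (norm (u n - z))\<^sup>2"
proof -
  have "\<Theta>' n \<bullet> (z - u n) + \<Theta> n (u n) \<le> \<Theta> n z"
    using Theta'_subgradient[of n] unfolding subdifferential_def by blast
  with assms(2) have "\<Theta>' n \<bullet> (z - u n) + \<Theta> n (u n) \<le> 0"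
    by simp
  from relaxed_step_fejer[OF this Theta_nonneg less_imp_le[OF lam_range(1)], of n]
  have "(norm (y n - z))\<^sup>2 + lam n * (2 - lam n) * (\<Theta> n (u n) / norm (\<Theta>' n))\<^sup>2
      \<le> (norm (u n - z))\<^sup>2"
    unfolding y_step .
  moreover have "(norm (u (Suc n) - z))\<^sup>2
      + \<nu> n * (2 - \<nu> n) * (max 0 (\<Phi> n (y n)) / norm (\<Phi>' n (y n)))\<^sup>2 \<le> (norm (y n - z))\<^sup>2"
    unfolding u_Suc
    by (rule relaxed_subgrad_proj_fejer[OF Phi'_subgradient assms(1) less_imp_le[OF nu_range(1)]])
  ultimately show ?thesis
    by linarith
qed

lemma
  assumes B1: "cofinitely_common_level \<Phi> \<Theta>"
  shows Theta_step_tendsto_0: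
      "uniformly_relaxed lam \<Longrightarrow> (\<lambda>n. \<Theta> n (u n) / norm (\<Theta>' n)) \<longlonglongrightarrow> 0"
    and Phi_step_tendsto_0:
      "uniformly_relaxed \<nu> \<Longrightarrow> (\<lambda>n. max 0 (\<Phi> n (y n)) / norm (\<Phi>' n (y n))) \<longlonglongrightarrow> 0"
    and L_bounded: "\<exists>D>0. \<forall>n. L n \<le> D"
proof -
  from B1 obtain z where z: "\<forall>\<^sub>F n in sequentially. \<Phi> n z \<le> 0 \<and> \<Theta> n z \<le> 0"
    by (rule cofinitely_common_levelE)
  define c where "c n = lam n * (2 - lam n) * (\<Theta> n (u n) / norm (\<Theta>' n))\<^sup>2" for n
  define d where "d n = \<nu> n * (2 - \<nu> n) * (max 0 (\<Phi> n (y n)) / norm (\<Phi>' n (y n)))\<^sup>2" for n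
  have c0: "0 \<le> c n" and d0: "0 \<le> d n" for n
    using lam_range[of n] nu_range[of n] by (auto simp: c_def d_def)
  \<comment> \<open>This one recursion yields all three claims: the vanishing defect gives both step
    limits, and the boundedness of the squared distances gives the bound on
    \<open>L\<close>.\<close>
  have "\<forall>\<^sub>F n in sequentially. (norm (u (Suc n) - z))\<^sup>2 + (c n + d n) \<le> (norm (u n - z))\<^sup>2"
    using z by (rule eventually_mono) (use fejer in \<open>auto simp: c_def d_def\<close>)
  from decreasing_defect_tendsto_0[OF this] c0 d0
  have lim: "(\<lambda>n. c n + d n) \<longlonglongrightarrow> 0" and bdd: "Bseq (\<lambda>n. (norm (u n - z))\<^sup>2)"
    by auto
  have "c \<longlonglongrightarrow> 0"
    by (rule tendsto_0_squeeze[OF lim]) (simp_all add: c0 d0)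
  then show "(\<lambda>n. \<Theta> n (u n) / norm (\<Theta>' n)) \<longlonglongrightarrow> 0" if "uniformly_relaxed lam"
    unfolding c_def[abs_def] by (rule uniformly_relaxed_step_tendsto_0[OF that])
  have "d \<longlonglongrightarrow> 0"
    by (rule tendsto_0_squeeze[OF lim]) (simp_all add: c0 d0)
  then show "(\<lambda>n. max 0 (\<Phi> n (y n)) / norm (\<Phi>' n (y n))) \<longlonglongrightarrow> 0" if "uniformly_relaxed \<nu>"
    unfolding d_def[abs_def] by (rule uniformly_relaxed_step_tendsto_0[OF that])
  from bdd obtain K where K: "K > 0" and uK: "\<And>n. (norm (u n - z))\<^sup>2 \<le> K"
    unfolding Bseq_def by auto
  have Lle: "\<forall>\<^sub>F n in sequentially. L n \<le> sqrt K"
    using z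
  proof (rule eventually_mono)
    fix n assume "\<Phi> n z \<le> 0 \<and> \<Theta> n z \<le> 0"
    \<comment> \<open>The point \<open>z\<close> lies in every active \<open>S i\<close>, so its
      distance to \<open>u n\<close> bounds all active distances.\<close>
    then have "infdist (u n) (S i) \<le> sqrt K" if "i \<in> I n" for i
      using infdist_le2[OF Theta_le_0_imp_mem[of n z i], of "u n" "sqrt K"] that uK[of n]
      by (simp add: dist_norm real_le_rsqrt)
    then show "L n \<le> sqrt K"
      using K by (intro L_le) auto
  qed
  have "0 \<le> L n" for n
    using L_pos[of n] by (cases "I n = {}") (auto simp: weighted_dist_def)
  \<comment> \<open>The bound \<open>sqrt K\<close> is known only from some index on;
    \<open>Bseq\<close> absorbs the finitely many earlier values.\<close>
  with Lle have "Bseq L"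
    by (intro BfunI[where K = "sqrt K"]) (auto elim: eventually_mono)
  then show "\<exists>D>0. \<forall>n. L n \<le> D"
    unfolding Bseq_def by (force intro: order_trans[OF abs_ge_self])
qed

lemma Theta_tendsto_0:
  assumes B1: "cofinitely_common_level \<Phi> \<Theta>" and B2: "uniformly_relaxed lam"
  shows "(\<lambda>n. \<Theta> n (u n)) \<longlonglongrightarrow> 0"
proof -
  from B1 obtain z where z: "\<forall>\<^sub>F n in sequentially. \<Phi> n z \<le> 0 \<and> \<Theta> n z \<le> 0"
    by (rule cofinitely_common_levelE)
  show ?thesis
  proof (rule tendsto_sandwich[OF _ _ tendsto_const Theta_step_tendsto_0[OF B1 B2]])
    show "\<forall>\<^sub>F n in sequentially. \<Theta> n (u n) \<le> \<Theta> n (u n) / norm (\<Theta>' n)"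
      using z
    proof (rule eventually_mono)
      fix n assume "\<Phi> n z \<le> 0 \<and> \<Theta> n z \<le> 0"
      \<comment> \<open>The common point \<open>z\<close> excludes a positive
        \<open>\<Theta> n (u n)\<close> with \<open>\<Theta>' n = 0\<close>, where the quotient
        would be 0 by convention.\<close>
      then have "\<Theta> n (u n) \<le> norm (\<Theta>' n) * (\<Theta> n (u n) / norm (\<Theta>' n))"
        using le_norm_subgradient_mult[OF Theta'_subgradient, of n z] Theta_nonneg[of n "u n"]
        by (simp add: max_absorb2)
      also have "\<dots> \<le> 1 * (\<Theta> n (u n) / norm (\<Theta>' n))"
        by (intro mult_right_mono norm_Theta'_le_1) (simp add: Theta_nonneg)
      finally show "\<Theta> n (u n) \<le> \<Theta> n (u n) / norm (\<Theta>' n)"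
        by simp
    qed
  qed (simp add: Theta_nonneg)
qed

lemma Max_infdist_tendsto_0:
  assumes B1: "cofinitely_common_level \<Phi> \<Theta>" and B2: "uniformly_relaxed lam"
    and B4: "weights_bounded_below S q \<omega> u"
  shows "(\<lambda>n. Max {infdist (u n) (S j) | j. j \<in> index_window q n}) \<longlonglongrightarrow> 0"
proof -
  \<comment> \<open>A real strictly below the infimum is chosen because the infimum itself is
    infinite when no index is ever active.\<close>
  from B4 obtain c where c: "0 < c"
    and ce: "ereal c < Inf {ereal (\<omega> n i) | n i. i \<in> I n}"
    unfolding weights_bounded_below_def using ereal_dense2[of 0] by auto
  have w: "c \<le> \<omega> n i" if "i \<in> I n" for n i
  proof -
    have "Inf {ereal (\<omega> n i) | n i. i \<in> I n} \<le> ereal (\<omega> n i)"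
      using that by (intro Inf_lower) blast
    with ce have "ereal c < ereal (\<omega> n i)"
      by (rule less_le_trans)
    then show ?thesis
      by simp
  qed
  let ?D = "\<lambda>n. (\<lambda>j. infdist (u n) (S j)) ` index_window q n"
  have D: "{infdist (u n) (S j) | j. j \<in> index_window q n} = ?D n" for n
    by blast
  \<comment> \<open>Since \<open>q \<ge> 1\<close>, the window contains \<open>n\<close>, so
    \<open>Max\<close> is taken over a nonempty set.\<close>
  have fin: "finite (?D n)" and n_in: "n \<in> index_window q n" for n
    using q_ge_1 by (auto simp: index_window_def)
  have nonneg: "0 \<le> Max (?D n)" for n
    using order_trans[OF infdist_nonneg Max_ge[OF fin imageI[OF n_in]]] .
  have le: "Max (?D n) \<le> \<Theta> n (u n) / c" for n
  proof (rule Max.boundedI[OF fin])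
    show "?D n \<noteq> {}"
      using n_in by blast
  qed (use infdist_le_Theta[OF w c] in auto)
  show ?thesis
    unfolding D
    by (rule tendsto_0_squeeze[OF tendsto_divide_zero[OF Theta_tendsto_0[OF B1 B2], of c] nonneg le])
qed

lemma near_points_in_S:
  assumes B1: "cofinitely_common_level \<Phi> \<Theta>" and B2: "uniformly_relaxed lam"
    and B4: "weights_bounded_below S q \<omega> u"
  obtains s where "\<And>n. s n \<in> S n" and "(\<lambda>n. dist (s n) (u n)) \<longlonglongrightarrow> 0"
proof -
  \<comment> \<open>Points that attain the distance up to a slack of \<open>1/(n+1)\<close> suffice
    in place of nearest points, as the slack tends to 0.\<close>
  have "\<exists>x\<in>S n. dist (u n) x < infdist (u n) (S n) + inverse (real (Suc n))" for n
    using cInf_lessD[of "dist (u n) ` S n" "infdist (u n) (S n) + inverse (real (Suc n))"]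
      S_nonempty[of n] by (auto simp: infdist_notempty simp del: of_nat_Suc)
  then obtain s where s: "\<And>n. s n \<in> S n"
    and d: "\<And>n. dist (u n) (s n) < infdist (u n) (S n) + inverse (real (Suc n))"
    by metis
  let ?M = "\<lambda>n. Max {infdist (u n) (S j) | j. j \<in> index_window q n}"
  have "infdist (u n) (S n) \<le> ?M n" for n
    by (rule Max_ge) (use q_ge_1 in \<open>auto simp: index_window_def\<close>)
  then have le: "dist (s n) (u n) \<le> ?M n + inverse (real (Suc n))" for n
    using order_trans[OF less_imp_le[OF d] add_right_mono] by (simp only: dist_commute)
  have "(\<lambda>n. ?M n + inverse (real (Suc n))) \<longlonglongrightarrow> 0"
    using tendsto_add[OF Max_infdist_tendsto_0[OF assms] LIMSEQ_inverse_real_of_nat] by simp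
  then have "(\<lambda>n. dist (s n) (u n)) \<longlonglongrightarrow> 0"
    by (rule tendsto_0_squeeze[OF _ zero_le_dist le])
  with s show thesis
    by (rule that)
qed

lemma dist_u_y_tendsto_0:
  assumes B1: "cofinitely_common_level \<Phi> \<Theta>" and B2: "uniformly_relaxed lam"
  shows "(\<lambda>n. norm (y n - u n)) \<longlonglongrightarrow> 0"
proof -
  have le: "norm (y n - u n) \<le> 2 * (\<Theta> n (u n) / norm (\<Theta>' n))" for n
  proof -
    \<comment> \<open>One factor \<open>norm (\<Theta>' n)\<close> cancels; when it is 0, both sides
      are 0.\<close>
    have "norm (y n - u n) = lam n * (\<Theta> n (u n) / norm (\<Theta>' n))"
      unfolding y_step using lam_range(1)[of n] Theta_nonneg[of n "u n"]
      by (simp add: power2_eq_square)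
    also have "\<dots> \<le> 2 * (\<Theta> n (u n) / norm (\<Theta>' n))"
      using lam_range(2)[of n] by (intro mult_right_mono) (auto simp: Theta_nonneg)
    finally show ?thesis .
  qed
  show ?thesis
    by (rule tendsto_0_squeeze[OF tendsto_mult_right_zero[OF Theta_step_tendsto_0[OF B1 B2], of 2]])
      (rule norm_ge_zero, rule le)
qed

text \<open>The bound on the subgradient at \<open>y n\<close> turns the vanishing step length into
  a vanishing positive part of \<open>\<Phi> n (y n)\<close>. The bound on the subgradient at
  \<open>u n\<close> then controls the change of value from \<open>y n\<close> to
  \<open>u n\<close>, whose distance tends to 0.\<close>

lemma max_0_Phi_tendsto_0:
  assumes B1: "cofinitely_common_level \<Phi> \<Theta>" and B2: "uniformly_relaxed lam"
    and B5: "uniformly_relaxed \<nu>" and B6: "subgradients_bounded \<Phi>' u y"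
  shows "(\<lambda>n. max 0 (\<Phi> n (u n))) \<longlonglongrightarrow> 0"
proof -
  from B6 obtain D where D: "D > 0"
    and Du: "\<And>n. norm (\<Phi>' n (u n)) \<le> D" and Dy: "\<And>n. norm (\<Phi>' n (y n)) \<le> D"
    unfolding subgradients_bounded_def by auto
  let ?b = "\<lambda>n. max 0 (\<Phi> n (y n)) / norm (\<Phi>' n (y n))"
  have le: "max 0 (\<Phi> n (u n)) \<le> D * ?b n + D * norm (y n - u n)" for n
  proof -
    from lev0_Phi_nonempty[of n] obtain z where "\<Phi> n z \<le> 0"
      by (auto simp: lev0_def)
    then have "max 0 (\<Phi> n (y n)) \<le> norm (\<Phi>' n (y n)) * ?b n"
      using le_norm_subgradient_mult[OF Phi'_subgradient] by blast
    also have "\<dots> \<le> D * ?b n"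
      by (intro mult_right_mono Dy) simp
    finally have 1: "max 0 (\<Phi> n (y n)) \<le> D * ?b n" .
    have "\<Phi>' n (u n) \<bullet> (y n - u n) + \<Phi> n (u n) \<le> \<Phi> n (y n)"
      using Phi'_subgradient[of n "u n"] unfolding subdifferential_def by blast
    moreover have "\<bar>\<Phi>' n (u n) \<bullet> (y n - u n)\<bar> \<le> D * norm (y n - u n)"
      by (rule order_trans[OF Cauchy_Schwarz_ineq2 mult_right_mono[OF Du norm_ge_zero]])
    ultimately have "\<Phi> n (u n) \<le> D * ?b n + D * norm (y n - u n)"
      using 1 by linarith
    moreover have "0 \<le> D * norm (y n - u n)"
      using D by simp
    ultimately show ?thesis
      using 1 by linarith
  qed
  have "(\<lambda>n. D * ?b n + D * norm (y n - u n)) \<longlonglongrightarrow> 0"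
    using Phi_step_tendsto_0[OF B1 B5] dist_u_y_tendsto_0[OF B1 B2]
    by (intro tendsto_add_zero tendsto_mult_right_zero)
  then show ?thesis
    by (rule tendsto_0_squeeze) (rule max.cobounded1, rule le)
qed

lemma limsup_Phi_le_0:
  assumes "cofinitely_common_level \<Phi> \<Theta>" and "uniformly_relaxed lam"
    and "uniformly_relaxed \<nu>" and "subgradients_bounded \<Phi>' u y"
  shows "limsup (\<lambda>n. ereal (\<Phi> n (u n))) \<le> 0"
proof -
  have "limsup (\<lambda>n. ereal (\<Phi> n (u n))) \<le> limsup (\<lambda>n. ereal (max 0 (\<Phi> n (u n))))"
    by (intro Limsup_mono always_eventually) simp
  also have "\<dots> = 0"
    using tendsto_ereal[OF max_0_Phi_tendsto_0[OF assms]]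
    by (intro lim_imp_Limsup) (simp_all add: zero_ereal_def del: ereal_max)
  finally show ?thesis .
qed

end

section \<open>Weighted l1 balls\<close>

lemma max_weighted_l1_lipschitz:
  fixes w x x' :: "real^'l"
  assumes w: "\<And>j. 0 \<le> w $ j \<and> w $ j \<le> b"
  shows "max 0 ((\<Sum>j\<in>UNIV. w $ j * \<bar>x $ j\<bar>) - \<rho>) - max 0 ((\<Sum>j\<in>UNIV. w $ j * \<bar>x' $ j\<bar>) - \<rho>)
           \<le> b * CARD('l) * norm (x - x')"
proof -
  have b: "0 \<le> b"
    using w order_trans by blast
  have "(\<Sum>j\<in>UNIV. w $ j * \<bar>x $ j\<bar>) - (\<Sum>j\<in>UNIV. w $ j * \<bar>x' $ j\<bar>)
      = (\<Sum>j\<in>UNIV. w $ j * (\<bar>x $ j\<bar> - \<bar>x' $ j\<bar>))"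
    by (simp add: sum_subtractf right_diff_distrib)
  \<comment> \<open>Each of the \<open>CARD('l)\<close> coordinates contributes at most
    \<open>b\<close> times the Euclidean norm, which explains the constant.\<close>
  also have "\<dots> \<le> (\<Sum>j\<in>(UNIV::'l set). b * norm (x - x'))"
  proof (rule sum_mono)
    fix j
    have "\<bar>x $ j\<bar> - \<bar>x' $ j\<bar> \<le> norm (x - x')"
      using component_le_norm_cart[of "x - x'" j] by simp
    then have "w $ j * (\<bar>x $ j\<bar> - \<bar>x' $ j\<bar>) \<le> w $ j * norm (x - x')"
      using w by (intro mult_left_mono) auto
    also have "\<dots> \<le> b * norm (x - x')"
      using w by (intro mult_right_mono) auto
    finally show "w $ j * (\<bar>x $ j\<bar> - \<bar>x' $ j\<bar>) \<le> b * norm (x - x')" .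
  qed
  finally have "(\<Sum>j\<in>UNIV. w $ j * \<bar>x $ j\<bar>) - (\<Sum>j\<in>UNIV. w $ j * \<bar>x' $ j\<bar>)
      \<le> b * CARD('l) * norm (x - x')"
    by (simp add: mult_ac)
  moreover have "0 \<le> b * CARD('l) * norm (x - x')"
    using b by simp
  \<comment> \<open>Taking positive parts preserves an upper bound on a difference as long as the
    bound is nonnegative.\<close>
  ultimately show ?thesis
    by linarith
qed

text \<open>A point outside the ball is scaled by \<open>\<rho> / f\<close> onto its boundary and
  moves by \<open>(f - \<rho>) / f * norm x\<close>. The Euclidean norm is at most the l1 norm, and
  the lower bound \<open>a\<close> on the weights bounds the latter by \<open>f / a\<close>.\<close>

lemma near_point_in_weighted_l1_ball:
  fixes w x :: "real^'l"
  assumes w: "\<And>j. a \<le> w $ j" and a: "0 < a" and \<rho>: "0 < \<rho>"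
  obtains s where "s \<in> weighted_l1_ball w \<rho>"
    and "dist s x \<le> max 0 ((\<Sum>j\<in>UNIV. w $ j * \<bar>x $ j\<bar>) - \<rho>) / a"
proof -
  define f where "f = (\<Sum>j\<in>UNIV. w $ j * \<bar>x $ j\<bar>)"
  show thesis
  proof (cases "f \<le> \<rho>")
    case True
    then show thesis
      using that[of x] a by (simp add: f_def weighted_l1_ball_def)
  next
    case False
    let ?s = "(\<rho> / f) *\<^sub>R x"
    have f: "0 < f"
      using False \<rho> by simp
    have "(\<Sum>j\<in>UNIV. w $ j * \<bar>?s $ j\<bar>) = (\<rho> / f) * f"
      unfolding f_def[of] sum_distrib_left using f \<rho>
      by (intro sum.cong) (auto simp: abs_mult f_def[symmetric])
    then have mem: "?s \<in> weighted_l1_ball w \<rho>"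
      using f by (simp add: weighted_l1_ball_def)
    have "a * norm x \<le> a * (\<Sum>j\<in>UNIV. \<bar>x $ j\<bar>)"
      using a by (intro mult_left_mono norm_le_l1_cart) auto
    also have "\<dots> \<le> f"
      unfolding f_def sum_distrib_left using w by (intro sum_mono mult_right_mono) auto
    finally have nx: "norm x \<le> f / a"
      using a by (simp add: field_simps)
    have "x - ?s = ((f - \<rho>) / f) *\<^sub>R x"
      using f by (simp add: scaleR_diff_left[symmetric] diff_divide_distrib scaleR_left_diff_distrib)
    then have "dist ?s x = (f - \<rho>) / f * norm x"
      using f False by (simp add: dist_norm norm_minus_commute)
    also have "\<dots> \<le> (f - \<rho>) / f * (f / a)"
      using f False by (intro mult_left_mono nx) auto
    also have "\<dots> = max 0 (f - \<rho>) / a"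
      using f False by simp
    finally show thesis
      using that[OF mem] by (simp add: f_def)
  qed
qed

text \<open>The uniform upper bound on the weights gives the \<open>\<Phi> n\<close> a common
  Lipschitz constant, which supplies the bound on subgradients that
  \<open>max_0_Phi_tendsto_0\<close> asks for. The lower bound on the weights controls the
  rescaling.\<close>

lemma near_points_in_weighted_l1_balls:
  fixes S :: "nat \<Rightarrow> (real^'l) set"
  assumes scheme: "subgrad_scheme S \<Phi> \<Phi>' lam \<nu> q \<omega> \<Theta>' u y"
    and \<rho>: "0 < \<rho>" and a: "0 < a" and w: "\<And>n j. w n $ j \<in> {a..b}"
    and \<Phi>: "\<And>n x. \<Phi> n x = max 0 ((\<Sum>j\<in>UNIV. w n $ j * \<bar>x $ j\<bar>) - \<rho>)"
    and B1: "cofinitely_common_level \<Phi> (\<lambda>n. dist_fun S q (\<omega> n) n (u n))"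
    and B2: "uniformly_relaxed lam" and B5: "uniformly_relaxed \<nu>"
  obtains s where "\<And>n. s n \<in> weighted_l1_ball (w n) \<rho>" and "(\<lambda>n. dist (s n) (u n)) \<longlonglongrightarrow> 0"
proof -
  have w': "0 \<le> w n $ j \<and> w n $ j \<le> b" for n j
    using w[of n j] a by simp
  then have b: "0 < b"
    using w a by (meson atLeastAtMost_iff less_le_trans)
  have "norm (\<Phi>' n x) \<le> b * CARD('l)" for n x
    by (rule subgradient_norm_le[OF subgrad_scheme.Phi'_subgradient[OF scheme]])
      (use b in \<open>auto simp: \<Phi> intro!: max_weighted_l1_lipschitz w'\<close>)
  then have "subgradients_bounded \<Phi>' u y"
    unfolding subgradients_bounded_def using b by (intro exI[of _ "b * CARD('l)"]) auto
  then have "(\<lambda>n. max 0 (\<Phi> n (u n))) \<longlonglongrightarrow> 0"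
    by (rule subgrad_scheme.max_0_Phi_tendsto_0[OF scheme B1 B2 B5])
  then have lim: "(\<lambda>n. \<Phi> n (u n) / a) \<longlonglongrightarrow> 0"
    using tendsto_divide_zero by (simp add: \<Phi>)
  have "\<exists>s. s \<in> weighted_l1_ball (w n) \<rho> \<and> dist s (u n) \<le> \<Phi> n (u n) / a" for n
  proof -
    have "a \<le> w n $ j" for j
      using w[of n j] by simp
    then show ?thesis
      unfolding \<Phi> using near_point_in_weighted_l1_ball[OF _ a \<rho>] by metis
  qed
  then obtain s where s: "\<And>n. s n \<in> weighted_l1_ball (w n) \<rho>"
    and le: "\<And>n. dist (s n) (u n) \<le> \<Phi> n (u n) / a"
    by metis
  have "(\<lambda>n. dist (s n) (u n)) \<longlonglongrightarrow> 0"
    by (rule tendsto_0_squeeze[OF lim zero_le_dist le])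
  with s show thesis
    by (rule that)
qed

section \<open>The five assertions together\<close>

theorem theorem31:
  shows
    "(\<forall>(S :: nat \<Rightarrow> 'a::{real_inner, complete_space} set) \<Phi> \<Phi>' lam \<nu> q \<omega> \<Theta>' u y \<Theta>.
        subgrad_scheme S \<Phi> \<Phi>' lam \<nu> q \<omega> \<Theta>' u y \<longrightarrow>
        \<Theta> = (\<lambda>n. dist_fun S q (\<omega> n) n (u n)) \<longrightarrow>
        (cofinitely_common_level \<Phi> \<Theta> \<longrightarrow>
           (\<exists>D>0. \<forall>n. weighted_dist S q (\<omega> n) n (u n) \<le> D)) \<and>
        (cofinitely_common_level \<Phi> \<Theta> \<and> uniformly_relaxed lam \<and>
         weights_bounded_below S q \<omega> u \<longrightarrow>
           (\<lambda>n. Max {infdist (u n) (S j) | j. j \<in> index_window q n}) \<longlonglongrightarrow> 0) \<and>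
        (cofinitely_common_level \<Phi> \<Theta> \<and> uniformly_relaxed lam \<and>
         cluster_points u \<noteq> {} \<and> weights_bounded_below S q \<omega> u \<longrightarrow>
           cluster_points u \<subseteq> set_limsup S \<and>
           (\<forall>u_star. u \<longlonglongrightarrow> u_star \<longrightarrow> u_star \<in> set_liminf S)) \<and>
        (cofinitely_common_level \<Phi> \<Theta> \<and> uniformly_relaxed lam \<and>
         uniformly_relaxed \<nu> \<and> subgradients_bounded \<Phi>' u y \<longrightarrow>
           limsup (\<lambda>n. ereal (\<Phi> n (u n))) \<le> 0 \<and>
           ((\<forall>n x. 0 \<le> \<Phi> n x) \<longrightarrow> (\<lambda>n. \<Phi> n (u n)) \<longlonglongrightarrow> 0))) \<and>
     (\<forall>(S :: nat \<Rightarrow> (real^'l) set) \<Phi> \<Phi>' lam \<nu> q \<omega> \<Theta>' u y \<Theta> w \<rho>.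
        subgrad_scheme S \<Phi> \<Phi>' lam \<nu> q \<omega> \<Theta>' u y \<longrightarrow>
        \<Theta> = (\<lambda>n. dist_fun S q (\<omega> n) n (u n)) \<longrightarrow>
        \<rho> > 0 \<longrightarrow>
        (\<exists>\<epsilon>1>0. \<exists>\<epsilon>2>0. \<forall>n j. w n $ j \<in> {\<epsilon>1..\<epsilon>2}) \<longrightarrow>
        (\<forall>n x. \<Phi> n x = max 0 ((\<Sum>j\<in>UNIV. w n $ j * \<bar>x $ j\<bar>) - \<rho>)) \<longrightarrow>
        cofinitely_common_level \<Phi> \<Theta> \<and> uniformly_relaxed lam \<and> uniformly_relaxed \<nu> \<longrightarrow>
          cluster_points u \<subseteq> set_limsup (\<lambda>n. weighted_l1_ball (w n) \<rho>) \<and>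
          (\<forall>u_star. u \<longlonglongrightarrow> u_star \<longrightarrow>
             u_star \<in> set_liminf (\<lambda>n. weighted_l1_ball (w n) \<rho>)))"
proof (intro conjI allI impI, goal_cases)
  \<comment> \<open>The third, fourth and fifth assertions each split into two goals, which makes
    eight cases.\<close>
  case (1 S \<Phi> \<Phi>' lam \<nu> q \<omega> \<Theta>' u y \<Theta>)
  show ?case
    by (rule subgrad_scheme.L_bounded[OF 1(1)]) (use 1 in simp)
next
  case (2 S \<Phi> \<Phi>' lam \<nu> q \<omega> \<Theta>' u y \<Theta>)
  show ?case
    by (rule subgrad_scheme.Max_infdist_tendsto_0[OF 2(1)]) (use 2 in simp_all)
next
  case (3 S \<Phi> \<Phi>' lam \<nu> q \<omega> \<Theta>' u y \<Theta>)
  then have B: "cofinitely_common_level \<Phi> (\<lambda>n. dist_fun S q (\<omega> n) n (u n))"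
      "uniformly_relaxed lam" "weights_bounded_below S q \<omega> u"
    by simp_all
  obtain s where "\<And>n. s n \<in> S n" and "(\<lambda>n. dist (s n) (u n)) \<longlonglongrightarrow> 0"
    using subgrad_scheme.near_points_in_S[OF 3(1) B] by metis
  then show ?case
    by (rule cluster_points_subset_set_limsup)
next
  case (4 S \<Phi> \<Phi>' lam \<nu> q \<omega> \<Theta>' u y \<Theta> u_star)
  then have B: "cofinitely_common_level \<Phi> (\<lambda>n. dist_fun S q (\<omega> n) n (u n))"
      "uniformly_relaxed lam" "weights_bounded_below S q \<omega> u"
    by simp_all
  obtain s where "\<And>n. s n \<in> S n" and "(\<lambda>n. dist (s n) (u n)) \<longlonglongrightarrow> 0"
    using subgrad_scheme.near_points_in_S[OF 4(1) B] by metis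
  then show ?case
    using 4(4) by (rule limit_in_set_liminf)
next
  case (5 S \<Phi> \<Phi>' lam \<nu> q \<omega> \<Theta>' u y \<Theta>)
  show ?case
    by (rule subgrad_scheme.limsup_Phi_le_0[OF 5(1)]) (use 5 in simp_all)
next
  case (6 S \<Phi> \<Phi>' lam \<nu> q \<omega> \<Theta>' u y \<Theta>)
  have "(\<lambda>n. max 0 (\<Phi> n (u n))) \<longlonglongrightarrow> 0"
    by (rule subgrad_scheme.max_0_Phi_tendsto_0[OF 6(1)]) (use 6 in simp_all)
  with 6(4) show ?case
    by (simp add: max_absorb2)
next
  case (7 S \<Phi> \<Phi>' lam \<nu> q \<omega> \<Theta>' u y \<Theta> w \<rho>)
  then have B: "cofinitely_common_level \<Phi> (\<lambda>n. dist_fun S q (\<omega> n) n (u n))"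
      "uniformly_relaxed lam" "uniformly_relaxed \<nu>"
    by simp_all
  from 7(4) obtain a b where "0 < a" "\<And>n j. w n $ j \<in> {a..b}"
    by blast
  then obtain s where "\<And>n. s n \<in> weighted_l1_ball (w n) \<rho>" and "(\<lambda>n. dist (s n) (u n)) \<longlonglongrightarrow> 0"
    using near_points_in_weighted_l1_balls[OF 7(1,3) _ _ spec[OF spec[OF 7(5)]] B] by metis
  then show ?case
    by (rule cluster_points_subset_set_limsup)
next
  case (8 S \<Phi> \<Phi>' lam \<nu> q \<omega> \<Theta>' u y \<Theta> w \<rho> u_star)
  then have B: "cofinitely_common_level \<Phi> (\<lambda>n. dist_fun S q (\<omega> n) n (u n))"
      "uniformly_relaxed lam" "uniformly_relaxed \<nu>"
    by simp_all
  from 8(4) obtain a b where "0 < a" "\<And>n j. w n $ j \<in> {a..b}"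
    by blast
  then obtain s where "\<And>n. s n \<in> weighted_l1_ball (w n) \<rho>" and "(\<lambda>n. dist (s n) (u n)) \<longlonglongrightarrow> 0"
    using near_points_in_weighted_l1_balls[OF 8(1,3) _ _ spec[OF spec[OF 8(5)]] B] by metis
  then show ?case
    using 8(7) by (rule limit_in_set_liminf)
qed

end
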